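(* Let $p$ be a prime, let $m\ge 1$ be an integer, and let $(a_n^{(i)})_{n\ge 0}$, $i=1,\dots,m+1$, be sequences of elements of $\mathbb{Q}_p$ with $a_0^{(m+1)}=1$. Define $A_{-j}^{(i)}=\delta_{ij}$ for $j=1,\dots,m$, $i=1,\dots,m+1$, $A_0^{(i)}=a_0^{(i)}$, $A_n^{(i)}=\sum_{j=1}^{m+1}a_n^{(j)}A_{n-j}^{(i)}$ for $n\ge1$, and the convergents $Q_n^{(i)}=A_n^{(i)}/A_n^{(m+1)}$ for $i=1,\dots,m$. Assume that for every $n\ge 1$, $$|a_n^{(1)}|\ge 1\quad\text{and}\quad |a_n^{(i)}|<|a_n^{(1)}|\ \text{ for } i=2,\dots,m+1,$$ where $|\cdot|$ is the $p$-adic absolute value. Then for each $i=1,\dots,m$ the sequence $(Q_n^{(i)})_{n\in\mathbb{N}}$ converges in $\mathbb{Q}_p$.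
   Context: $\delta_{ij}$ is the Kronecker delta. (Under the hypotheses, $A_n^{(m+1)}\neq 0$ for $n\ge 1$, so the convergents are defined.) *)

theory Defs
  imports "HOL-Analysis.Elementary_Normed_Spaces" "Berlekamp_Zassenhaus.Finite_Field"
begin

section \<open>The p-adic absolute value on the rationals\<close>

definition padic_val :: "nat \<Rightarrow> rat \<Rightarrow> int" where
  "padic_val p x =
     int (multiplicity (int p) (fst (quotient_of x))) -
     int (multiplicity (int p) (snd (quotient_of x)))"

definition padic_abs :: "nat \<Rightarrow> rat \<Rightarrow> real" where
  "padic_abs p x = (if x = 0 then 0 else real p powi (- padic_val p x))"

lemma padic_abs_zero [simp]: "padic_abs p 0 = 0"
  by (simp add: padic_abs_def)

context
  fixes p :: nat
  assumes p: "prime p"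
begin

lemma padic_val_of_int_divide:
  assumes "a \<noteq> 0" "b \<noteq> 0"
  shows "padic_val p (of_int a / of_int b) =
           int (multiplicity (int p) a) - int (multiplicity (int p) b)"
proof -
  obtain c d where cd: "quotient_of (of_int a / of_int b :: rat) = (c, d)"
    by fastforce
  have d: "d > 0" using cd quotient_of_denom_pos by blast
  have eq: "(of_int a / of_int b :: rat) = of_int c / of_int d"
    using cd by (rule quotient_of_div)
  have "(of_int (a * d) :: rat) = of_int (c * b)"
    using eq assms d by (simp add: field_simps)
  then have ad: "a * d = c * b" by (simp only: of_int_eq_iff)
  then have c: "c \<noteq> 0" using assms d by auto
  have pe: "prime_elem (int p)" using p by simp
  have "multiplicity (int p) a + multiplicity (int p) d =
        multiplicity (int p) c + multiplicity (int p) b"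
    using arg_cong[OF ad, of "multiplicity (int p)"] assms c d
    by (simp add: prime_elem_multiplicity_mult_distrib[OF pe])
  then show ?thesis unfolding padic_val_def cd by simp
qed

lemma rat_fraction_cases:
  obtains a b :: int where "x = (of_int a / of_int b :: rat)" "b \<noteq> 0"
proof -
  obtain a b where ab: "quotient_of x = (a, b)" by fastforce
  show ?thesis using that[of a b] quotient_of_div[OF ab] quotient_of_denom_pos[OF ab] by simp
qed

lemma padic_abs_nonneg [simp]: "0 \<le> padic_abs p x"
  by (simp add: padic_abs_def)

lemma padic_abs_eq_0_iff [simp]: "padic_abs p x = 0 \<longleftrightarrow> x = 0"
  using prime_gt_0_nat[OF p] by (simp add: padic_abs_def)

lemma padic_abs_mult: "padic_abs p (x * y) = padic_abs p x * padic_abs p y"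
proof (cases "x = 0 \<or> y = 0")
  case False
  obtain a b where x: "x = of_int a / of_int b" "b \<noteq> 0" by (rule rat_fraction_cases)
  obtain c d where y: "y = of_int c / of_int d" "d \<noteq> 0" by (rule rat_fraction_cases)
  have ac: "a \<noteq> 0" "c \<noteq> 0" using x y False by auto
  have xy: "x * y = of_int (a * c) / of_int (b * d)" using x y by simp
  have pe: "prime_elem (int p)" using p by simp
  have "padic_val p (x * y) = padic_val p x + padic_val p y"
    unfolding xy unfolding x y using ac x(2) y(2)
    by (subst (1 2 3) padic_val_of_int_divide)
       (simp_all add: prime_elem_multiplicity_mult_distrib[OF pe])
  then show ?thesis
    using False prime_gt_0_nat[OF p]
    by (simp add: padic_abs_def power_int_add[symmetric] add.commute)
qed auto

lemma padic_abs_one [simp]: "padic_abs p 1 = 1"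
  using padic_abs_mult[of 1 1] by simp

lemma padic_abs_minus [simp]: "padic_abs p (- x) = padic_abs p x"
proof -
  have "padic_abs p (- 1) * padic_abs p (- 1) = 1"
    by (simp add: padic_abs_mult[symmetric])
  then have "padic_abs p (- 1) = 1"
    using padic_abs_nonneg[of "- 1"] by (metis abs_of_nonneg real_sqrt_abs2 real_sqrt_one)
  then show ?thesis using padic_abs_mult[of "- 1" x] by simp
qed

lemma padic_abs_minus_commute: "padic_abs p (x - y) = padic_abs p (y - x)"
  using padic_abs_minus[of "x - y"] by simp

lemma padic_abs_inverse: "padic_abs p (inverse x) = inverse (padic_abs p x)"
proof (cases "x = 0")
  case False
  then show ?thesis using padic_abs_mult[of x "inverse x"]
    by (simp add: inverse_unique)
qed simp

lemma padic_abs_ultra: "padic_abs p (x + y) \<le> max (padic_abs p x) (padic_abs p y)"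
proof (cases "x = 0 \<or> y = 0 \<or> x + y = 0")
  case False
  obtain a b where x: "x = of_int a / of_int b" "b \<noteq> 0" by (rule rat_fraction_cases)
  obtain c d where y: "y = of_int c / of_int d" "d \<noteq> 0" by (rule rat_fraction_cases)
  have x': "x = of_int (a * d) / of_int (b * d)" and y': "y = of_int (c * b) / of_int (b * d)"
    using x y by simp_all
  have xy: "x + y = of_int (a * d + c * b) / of_int (b * d)"
    unfolding x' y' by (simp add: add_divide_distrib)
  have nz: "a * d \<noteq> 0" "c * b \<noteq> 0" "b * d \<noteq> 0" "a * d + c * b \<noteq> 0"
    using x y xy False by (auto simp del: of_int_add of_int_mult)
  have p1: "\<not> is_unit (int p)" using prime_gt_1_nat[OF p] by simp
  let ?m = "min (multiplicity (int p) (a * d)) (multiplicity (int p) (c * b))"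
  have "int p ^ ?m dvd a * d" "int p ^ ?m dvd c * b"
    by (rule multiplicity_dvd', simp)+
  then have "int p ^ ?m dvd a * d + c * b" by simp
  then have "?m \<le> multiplicity (int p) (a * d + c * b)"
    using nz p1 by (intro multiplicity_geI) auto
  then have "padic_val p (x + y) \<ge> min (padic_val p x) (padic_val p y)"
    unfolding xy unfolding x' y'
    by (subst (1 2 3) padic_val_of_int_divide) (use nz in auto)
  then have "- padic_val p (x + y) \<le> - padic_val p x \<or> - padic_val p (x + y) \<le> - padic_val p y"
    by linarith
  moreover have "1 \<le> real p" using prime_gt_0_nat[OF p] by simp
  ultimately show ?thesis
    using False by (auto simp: padic_abs_def le_max_iff_disj intro: power_int_increasing)
qed (auto simp: add_eq_0_iff max_def)

lemma padic_abs_triangle: "padic_abs p (x + y) \<le> padic_abs p x + padic_abs p y"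
  using padic_abs_ultra[of x y] padic_abs_nonneg[of x] padic_abs_nonneg[of y] by linarith

lemma padic_abs_triangle_diff: "\<bar>padic_abs p x - padic_abs p y\<bar> \<le> padic_abs p (x - y)"
  using padic_abs_triangle[of "x - y" y] padic_abs_triangle[of "y - x" x]
    padic_abs_minus_commute[of x y] by auto

end


section \<open>The field of p-adic numbers\<close>

definition padic_cauchy :: "nat \<Rightarrow> (nat \<Rightarrow> rat) \<Rightarrow> bool" where
  "padic_cauchy p X \<longleftrightarrow> (\<forall>e>0. \<exists>M. \<forall>m\<ge>M. \<forall>n\<ge>M. padic_abs p (X m - X n) < e)"

definition padic_null :: "nat \<Rightarrow> (nat \<Rightarrow> rat) \<Rightarrow> bool" where
  "padic_null p X \<longleftrightarrow> (\<lambda>n. padic_abs p (X n)) \<longlonglongrightarrow> 0"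

definition padic_rel :: "nat \<Rightarrow> (nat \<Rightarrow> rat) \<Rightarrow> (nat \<Rightarrow> rat) \<Rightarrow> bool" where
  "padic_rel p X Y \<longleftrightarrow> padic_cauchy p X \<and> padic_cauchy p Y \<and> padic_null p (\<lambda>n. X n - Y n)"

lemma padic_cauchyD:
  "padic_cauchy p X \<Longrightarrow> 0 < e \<Longrightarrow> \<exists>M. \<forall>m\<ge>M. \<forall>n\<ge>M. padic_abs p (X m - X n) < e"
  by (simp add: padic_cauchy_def)

lemma padic_null_zero [simp]: "padic_null p (\<lambda>n. 0)"
  by (simp add: padic_null_def)

lemma padic_cauchy_const [simp]: "padic_cauchy p (\<lambda>n. c)"
  by (simp add: padic_cauchy_def)

lemma padic_rel_refl: "padic_cauchy p X \<Longrightarrow> padic_rel p X X"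
  by (simp add: padic_rel_def)

context
  fixes p :: nat
  assumes p: "prime p"
begin

lemma padic_null_le:
  assumes "padic_null p X" "padic_null p Y"
    and "\<And>n. padic_abs p (Z n) \<le> padic_abs p (X n) + padic_abs p (Y n)"
  shows "padic_null p Z"
proof -
  have "(\<lambda>n. padic_abs p (X n) + padic_abs p (Y n)) \<longlonglongrightarrow> 0"
    using tendsto_add[OF assms(1,2)[unfolded padic_null_def]] by simp
  then show ?thesis unfolding padic_null_def
    by (rule Lim_null_comparison[rotated]) (simp add: p assms(3))
qed

lemma padic_null_add: "padic_null p X \<Longrightarrow> padic_null p Y \<Longrightarrow> padic_null p (\<lambda>n. X n + Y n)"
  by (erule (1) padic_null_le) (rule padic_abs_triangle[OF p])

lemma padic_null_minus: "padic_null p X \<Longrightarrow> padic_null p (\<lambda>n. - X n)"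
  by (simp add: padic_null_def p)

lemma padic_cauchy_add:
  assumes "padic_cauchy p X" "padic_cauchy p Y"
  shows "padic_cauchy p (\<lambda>n. X n + Y n)"
  unfolding padic_cauchy_def
proof (intro allI impI)
  fix e :: real assume "e > 0"
  obtain M where M: "\<And>m n. m \<ge> M \<Longrightarrow> n \<ge> M \<Longrightarrow> padic_abs p (X m - X n) < e"
    using padic_cauchyD[OF assms(1) \<open>e > 0\<close>] by blast
  obtain N where N: "\<And>m n. m \<ge> N \<Longrightarrow> n \<ge> N \<Longrightarrow> padic_abs p (Y m - Y n) < e"
    using padic_cauchyD[OF assms(2) \<open>e > 0\<close>] by blast
  have "padic_abs p (X m + Y m - (X n + Y n)) < e" if "m \<ge> max M N" "n \<ge> max M N" for m n
    using padic_abs_ultra[OF p, of "X m - X n" "Y m - Y n"] M[of m n] N[of m n] that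
    by (simp add: algebra_simps)
  then show "\<exists>M. \<forall>m\<ge>M. \<forall>n\<ge>M. padic_abs p (X m + Y m - (X n + Y n)) < e" by blast
qed

lemma padic_cauchy_minus: "padic_cauchy p X \<Longrightarrow> padic_cauchy p (\<lambda>n. - X n)"
  unfolding padic_cauchy_def
  by (simp only: minus_diff_minus padic_abs_minus[OF p])

lemma padic_cauchy_abs_convergent:
  assumes "padic_cauchy p X"
  shows "convergent (\<lambda>n. padic_abs p (X n))"
proof (rule Cauchy_convergent, rule CauchyI)
  fix e :: real assume "e > 0"
  obtain M where M: "\<And>m n. m \<ge> M \<Longrightarrow> n \<ge> M \<Longrightarrow> padic_abs p (X m - X n) < e"
    using padic_cauchyD[OF assms \<open>e > 0\<close>] by blast
  have "norm (padic_abs p (X m) - padic_abs p (X n)) < e" if "m \<ge> M" "n \<ge> M" for m n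
    using padic_abs_triangle_diff[OF p, of "X m" "X n"] M[OF that] by simp
  then show "\<exists>M. \<forall>m\<ge>M. \<forall>n\<ge>M. norm (padic_abs p (X m) - padic_abs p (X n)) < e" by blast
qed

lemma padic_cauchy_bounded:
  assumes "padic_cauchy p X"
  obtains B where "B > 0" "\<And>n. padic_abs p (X n) \<le> B"
proof -
  have "Bseq (\<lambda>n. padic_abs p (X n))"
    using padic_cauchy_abs_convergent[OF assms] by (rule convergent_imp_Bseq)
  then obtain B where B: "B > 0" "\<And>n. norm (padic_abs p (X n)) \<le> B"
    by (elim BseqE) blast
  show ?thesis
  proof (rule that[OF B(1)])
    show "padic_abs p (X n) \<le> B" for n using B(2)[of n] by simp
  qed
qed

lemma padic_null_mult_bounded:
  assumes "padic_null p X" "padic_cauchy p Y"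
  shows "padic_null p (\<lambda>n. Y n * X n)"
proof -
  obtain B where B: "B > 0" "\<And>n. padic_abs p (Y n) \<le> B"
    by (rule padic_cauchy_bounded[OF assms(2)]) blast
  have "(\<lambda>n. B * padic_abs p (X n)) \<longlonglongrightarrow> 0"
    using tendsto_mult_right_zero assms(1) unfolding padic_null_def by blast
  then show ?thesis unfolding padic_null_def
    by (rule Lim_null_comparison[rotated])
       (simp add: p padic_abs_mult B mult_right_mono)
qed

lemma padic_cauchy_mult:
  assumes "padic_cauchy p X" "padic_cauchy p Y"
  shows "padic_cauchy p (\<lambda>n. X n * Y n)"
  unfolding padic_cauchy_def
proof (intro allI impI)
  fix e :: real assume e: "e > 0"
  obtain B where B: "B > 0" "\<And>n. padic_abs p (X n) \<le> B"
    by (rule padic_cauchy_bounded[OF assms(1)]) blast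
  obtain C where C: "C > 0" "\<And>n. padic_abs p (Y n) \<le> C"
    by (rule padic_cauchy_bounded[OF assms(2)]) blast
  obtain M where M: "\<And>m n. m \<ge> M \<Longrightarrow> n \<ge> M \<Longrightarrow> padic_abs p (X m - X n) < e / C"
    using padic_cauchyD[OF assms(1), of "e / C"] e C(1) by auto
  obtain N where N: "\<And>m n. m \<ge> N \<Longrightarrow> n \<ge> N \<Longrightarrow> padic_abs p (Y m - Y n) < e / B"
    using padic_cauchyD[OF assms(2), of "e / B"] e B(1) by auto
  have "padic_abs p (X m * Y m - X n * Y n) < e" if "m \<ge> max M N" "n \<ge> max M N" for m n
  proof -
    have "padic_abs p (X m * (Y m - Y n)) \<le> B * padic_abs p (Y m - Y n)"
      by (simp add: padic_abs_mult p B mult_right_mono)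
    also have "\<dots> < e" using N[of m n] that B(1) by (simp add: field_simps)
    finally have 1: "padic_abs p (X m * (Y m - Y n)) < e" .
    have "padic_abs p ((X m - X n) * Y n) \<le> padic_abs p (X m - X n) * C"
      by (simp add: padic_abs_mult p C mult_left_mono)
    also have "\<dots> < e" using M[of m n] that C(1) by (simp add: field_simps)
    finally have 2: "padic_abs p ((X m - X n) * Y n) < e" .
    show ?thesis
      using padic_abs_ultra[OF p, of "X m * (Y m - Y n)" "(X m - X n) * Y n"] 1 2
      by (simp add: algebra_simps)
  qed
  then show "\<exists>M. \<forall>m\<ge>M. \<forall>n\<ge>M. padic_abs p (X m * Y m - X n * Y n) < e" by blast
qed

lemma padic_cauchy_not_null:
  assumes "padic_cauchy p X" "\<not> padic_null p X"
  obtains b M where "b > 0" "\<And>n. n \<ge> M \<Longrightarrow> padic_abs p (X n) > b"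
proof -
  obtain L where L: "(\<lambda>n. padic_abs p (X n)) \<longlonglongrightarrow> L"
    using padic_cauchy_abs_convergent[OF assms(1)] by (auto simp: convergent_def)
  have "L \<ge> 0" by (rule LIMSEQ_le_const[OF L]) (simp add: p)
  moreover have "L \<noteq> 0" using L assms(2) by (auto simp: padic_null_def)
  ultimately have "L > 0" by simp
  then have "eventually (\<lambda>n. padic_abs p (X n) > L / 2) sequentially"
    by (intro order_tendstoD(1)[OF L]) simp
  then show ?thesis using that[of "L / 2"] \<open>L > 0\<close> by (auto simp: eventually_sequentially)
qed

lemma padic_cauchy_inverse:
  assumes "padic_cauchy p X" "\<not> padic_null p X"
  shows "padic_cauchy p (\<lambda>n. inverse (X n))"
  unfolding padic_cauchy_def
proof (intro allI impI)
  fix e :: real assume e: "e > 0"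
  obtain b M where b: "b > 0" "\<And>n. n \<ge> M \<Longrightarrow> padic_abs p (X n) > b"
    by (rule padic_cauchy_not_null[OF assms]) blast
  obtain N where N: "\<And>m n. m \<ge> N \<Longrightarrow> n \<ge> N \<Longrightarrow> padic_abs p (X m - X n) < e * (b * b)"
    using padic_cauchyD[OF assms(1), of "e * (b * b)"] e b(1) by auto
  have "padic_abs p (inverse (X m) - inverse (X n)) < e" if "m \<ge> max M N" "n \<ge> max M N" for m n
  proof -
    have bb: "b < padic_abs p (X m)" "b < padic_abs p (X n)" using b that by auto
    then have nz: "X m \<noteq> 0" "X n \<noteq> 0" using b(1) by auto
    have "inverse (X m) - inverse (X n) = (X n - X m) * inverse (X m * X n)"
      using nz by (simp add: field_simps)
    then have eq: "padic_abs p (inverse (X m) - inverse (X n)) =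
        padic_abs p (X n - X m) / (padic_abs p (X m) * padic_abs p (X n))"
      by (simp only: padic_abs_mult[OF p] padic_abs_inverse[OF p] divide_inverse)
    have "b * b < padic_abs p (X m) * padic_abs p (X n)"
      using bb b(1) by (intro mult_strict_mono) auto
    then have "e * (b * b) < e * (padic_abs p (X m) * padic_abs p (X n))"
      using e by simp
    then have "padic_abs p (X n - X m) < e * (padic_abs p (X m) * padic_abs p (X n))"
      using N[of n m] that by auto
    moreover have "0 < padic_abs p (X m) * padic_abs p (X n)"
      using bb b(1) by (intro mult_pos_pos) linarith+
    ultimately show ?thesis unfolding eq by (simp add: pos_divide_less_eq)
  qed
  then show "\<exists>M. \<forall>m\<ge>M. \<forall>n\<ge>M. padic_abs p (inverse (X m) - inverse (X n)) < e" by blast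
qed

lemma padic_inverse_null:
  assumes "padic_cauchy p X" "\<not> padic_null p X"
  shows "padic_null p (\<lambda>n. inverse (X n) * X n - 1)"
proof -
  obtain b M where b: "b > 0" "\<And>n. n \<ge> M \<Longrightarrow> padic_abs p (X n) > b"
    by (rule padic_cauchy_not_null[OF assms]) blast
  have "inverse (X n) * X n - 1 = 0" if "n \<ge> M" for n
  proof -
    have "X n \<noteq> 0" using b(2)[OF that] b(1) by auto
    then show ?thesis by simp
  qed
  then have "padic_abs p (inverse (X n) * X n - 1) = 0" if "n \<ge> M" for n
    using that by (simp only: padic_abs_zero)
  then have "eventually (\<lambda>n. padic_abs p (inverse (X n) * X n - 1) = 0) sequentially"
    unfolding eventually_sequentially by blast
  then show ?thesis unfolding padic_null_def by (rule tendsto_eventually)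
qed

lemma padic_rel_sym: "padic_rel p X Y \<Longrightarrow> padic_rel p Y X"
  by (simp add: padic_rel_def padic_null_def padic_abs_minus_commute[OF p])

lemma padic_rel_trans:
  assumes "padic_rel p X Y" "padic_rel p Y Z"
  shows "padic_rel p X Z"
  using assms padic_null_add[of "\<lambda>n. X n - Y n" "\<lambda>n. Y n - Z n"]
  by (simp add: padic_rel_def)

lemma part_equivp_padic_rel: "part_equivp (padic_rel p)"
proof (rule part_equivpI)
  show "\<exists>X. padic_rel p X X" using padic_rel_refl padic_cauchy_const by blast
qed (auto intro: sympI transpI padic_rel_sym padic_rel_trans)

lemma padic_rel_add:
  assumes "padic_rel p X X'" "padic_rel p Y Y'"
  shows "padic_rel p (\<lambda>n. X n + Y n) (\<lambda>n. X' n + Y' n)"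
  using assms padic_null_add[of "\<lambda>n. X n - X' n" "\<lambda>n. Y n - Y' n"]
  by (simp add: padic_rel_def padic_cauchy_add add_diff_add)

lemma padic_rel_minus:
  assumes "padic_rel p X X'"
  shows "padic_rel p (\<lambda>n. - X n) (\<lambda>n. - X' n)"
  using assms padic_null_minus[of "\<lambda>n. X n - X' n"]
  by (simp add: padic_rel_def padic_cauchy_minus)

lemma padic_rel_mult:
  assumes "padic_rel p X X'" "padic_rel p Y Y'"
  shows "padic_rel p (\<lambda>n. X n * Y n) (\<lambda>n. X' n * Y' n)"
proof -
  have "padic_null p (\<lambda>n. X n * (Y n - Y' n) + Y' n * (X n - X' n))"
    using assms by (intro padic_null_add padic_null_mult_bounded) (auto simp: padic_rel_def)
  then show ?thesis
    using assms by (simp add: padic_rel_def padic_cauchy_mult algebra_simps)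
qed

lemma padic_rel_null_iff:
  assumes "padic_rel p X Y"
  shows "padic_null p X \<longleftrightarrow> padic_null p Y"
proof
  assume "padic_null p X"
  then show "padic_null p Y"
    using padic_null_add[of X "\<lambda>n. - (X n - Y n)"] padic_null_minus[of "\<lambda>n. X n - Y n"] assms
    by (simp add: padic_rel_def)
next
  assume "padic_null p Y"
  then show "padic_null p X"
    using padic_null_add[of Y "\<lambda>n. X n - Y n"] assms by (simp add: padic_rel_def)
qed

lemma padic_rel_inverse:
  assumes XY: "padic_rel p X Y" and X0: "\<not> padic_null p X"
  shows "padic_rel p (\<lambda>n. inverse (X n)) (\<lambda>n. inverse (Y n))"
proof -
  have X: "padic_cauchy p X" and Y: "padic_cauchy p Y" using XY by (auto simp: padic_rel_def)
  have Y0: "\<not> padic_null p Y" using padic_rel_null_iff[OF XY] X0 by simp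
  note iX = padic_cauchy_inverse[OF X X0] and iY = padic_cauchy_inverse[OF Y Y0]
  have r1: "padic_rel p (\<lambda>n. inverse (X n) * X n) (\<lambda>n. 1)"
    using padic_inverse_null[OF X X0] X iX by (simp add: padic_rel_def padic_cauchy_mult)
  have r2: "padic_rel p (\<lambda>n. inverse (Y n) * Y n) (\<lambda>n. 1)"
    using padic_inverse_null[OF Y Y0] Y iY by (simp add: padic_rel_def padic_cauchy_mult)
  have a: "padic_rel p (\<lambda>n. inverse (X n) * 1) (\<lambda>n. inverse (X n) * (inverse (Y n) * Y n))"
    by (rule padic_rel_mult[OF padic_rel_refl[OF iX] padic_rel_sym[OF r2]])
  have b: "padic_rel p (\<lambda>n. inverse (X n) * (inverse (Y n) * Y n))
             (\<lambda>n. inverse (X n) * (inverse (Y n) * X n))"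
    by (intro padic_rel_mult padic_rel_refl iX iY padic_rel_sym[OF XY])
  have c: "padic_rel p (\<lambda>n. inverse (Y n) * (inverse (X n) * X n)) (\<lambda>n. inverse (Y n) * 1)"
    by (rule padic_rel_mult[OF padic_rel_refl[OF iY] r1])
  show ?thesis
    using padic_rel_trans[OF padic_rel_trans[OF a b]] c by (simp add: mult.left_commute)
qed

lemma padic_rel_lim_abs:
  assumes "padic_rel p X Y"
  shows "lim (\<lambda>n. padic_abs p (X n)) = lim (\<lambda>n. padic_abs p (Y n))"
proof -
  have "(\<lambda>n. padic_abs p (X n)) \<longlonglongrightarrow> lim (\<lambda>n. padic_abs p (X n))"
    using assms padic_cauchy_abs_convergent by (simp add: padic_rel_def convergent_LIMSEQ_iff)
  moreover have "(\<lambda>n. padic_abs p (Y n) - padic_abs p (X n)) \<longlonglongrightarrow> 0"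
  proof (rule Lim_null_comparison)
    show "(\<lambda>n. padic_abs p (Y n - X n)) \<longlonglongrightarrow> 0"
      using padic_rel_sym[OF assms] by (simp add: padic_rel_def padic_null_def)
  qed (simp add: padic_abs_triangle_diff[OF p])
  ultimately have "(\<lambda>n. padic_abs p (X n) + (padic_abs p (Y n) - padic_abs p (X n)))
      \<longlonglongrightarrow> lim (\<lambda>n. padic_abs p (X n)) + 0"
    by (rule tendsto_add)
  then have "(\<lambda>n. padic_abs p (Y n)) \<longlonglongrightarrow> lim (\<lambda>n. padic_abs p (X n))" by simp
  then show ?thesis by (simp add: limI)
qed

end

text \<open>
  The prime is carried by the type: for \<open>'p :: prime_card\<close>, the type \<open>'p padic\<close> is the field of
  \<open>p\<close>-adic numbers for \<open>p = CARD('p)\<close>, that is, the completion of \<open>rat\<close> with respect to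
  \<open>padic_abs p\<close>. Every prime is of the form \<open>CARD('p)\<close>, so that a statement about an arbitrary
  \<open>'p :: prime_card\<close> is a statement about an arbitrary prime.
\<close>

typedef ('p::prime_card) padic =
    "{C. \<exists>X. padic_rel CARD('p) X X \<and> C = Collect (padic_rel CARD('p) X)}"
  morphisms class_of_padic padic_of_class
  using padic_rel_refl padic_cauchy_const by blast

definition abs_padic :: "(nat \<Rightarrow> rat) \<Rightarrow> 'p::prime_card padic" where
  "abs_padic X = padic_of_class (Collect (padic_rel CARD('p) X))"

definition rep_padic :: "'p::prime_card padic \<Rightarrow> nat \<Rightarrow> rat" where
  "rep_padic x = (SOME X. X \<in> class_of_padic x)"

definition cr_padic :: "(nat \<Rightarrow> rat) \<Rightarrow> 'p::prime_card padic \<Rightarrow> bool" where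
  "cr_padic X x \<longleftrightarrow> padic_rel CARD('p) X X \<and> abs_padic X = x"

lemma Quotient3_padic:
  "Quotient3 (padic_rel CARD('p)) (abs_padic :: _ \<Rightarrow> 'p::prime_card padic) rep_padic"
proof -
  interpret quot_type "padic_rel CARD('p)" "padic_of_class :: _ \<Rightarrow> 'p padic" class_of_padic
  proof
    show "part_equivp (padic_rel CARD('p))" by (rule part_equivp_padic_rel[OF prime_card])
    show "\<exists>X. padic_rel CARD('p) X X \<and> class_of_padic x = Collect (padic_rel CARD('p) X)"
      for x :: "'p padic"
      using class_of_padic[of x] by simp
    show "padic_of_class (class_of_padic x) = x" for x :: "'p padic"
      by (rule class_of_padic_inverse)
    show "class_of_padic (padic_of_class C :: 'p padic) = C"
      if "\<exists>X. padic_rel CARD('p) X X \<and> C = Collect (padic_rel CARD('p) X)" for C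
      using that by (intro padic_of_class_inverse) simp
    show "class_of_padic x = class_of_padic y \<longleftrightarrow> x = y" for x y :: "'p padic"
      by (rule class_of_padic_inject)
  qed
  have "abs_padic = abs" "rep_padic = rep"
    by (simp_all add: fun_eq_iff abs_padic_def rep_padic_def abs_def rep_def)
  then show ?thesis using Quotient by simp
qed

lemma Quotient_padic:
  "Quotient (padic_rel CARD('p)) (abs_padic :: _ \<Rightarrow> 'p::prime_card padic) rep_padic cr_padic"
  by (rule Quotient3_to_Quotient[OF Quotient3_padic])
     (simp add: cr_padic_def[abs_def] fun_eq_iff)

setup_lifting Quotient_padic

instantiation padic :: (prime_card) field
begin

lift_definition zero_padic :: "'a padic" is "\<lambda>n. 0"
  by (simp add: padic_rel_refl)

lift_definition one_padic :: "'a padic" is "\<lambda>n. 1"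
  by (simp add: padic_rel_refl)

lift_definition plus_padic :: "'a padic \<Rightarrow> 'a padic \<Rightarrow> 'a padic" is "\<lambda>X Y n. X n + Y n"
  by (rule padic_rel_add[OF prime_card])

lift_definition uminus_padic :: "'a padic \<Rightarrow> 'a padic" is "\<lambda>X n. - X n"
  by (rule padic_rel_minus[OF prime_card])

lift_definition times_padic :: "'a padic \<Rightarrow> 'a padic \<Rightarrow> 'a padic" is "\<lambda>X Y n. X n * Y n"
  by (rule padic_rel_mult[OF prime_card])

lift_definition inverse_padic :: "'a padic \<Rightarrow> 'a padic"
  is "\<lambda>X. if padic_null CARD('a) X then (\<lambda>n. 0) else (\<lambda>n. inverse (X n))"
  using padic_rel_null_iff[OF prime_card] padic_rel_inverse[OF prime_card]
  by (auto simp: padic_rel_refl)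

definition "x - y = x + - y" for x y :: "'a padic"

definition "x div y = x * inverse y" for x y :: "'a padic"

instance
proof
  note cauchy_simps = padic_rel_def padic_cauchy_add[OF prime_card]
    padic_cauchy_minus[OF prime_card] padic_cauchy_mult[OF prime_card]
  fix a b c :: "'a padic"
  show "a + b = b + a"
    by transfer (simp add: ac_simps cauchy_simps)
  show "(a + b) + c = a + (b + c)"
    by transfer (simp add: ac_simps cauchy_simps)
  show "0 + a = a"
    by transfer (simp add: cauchy_simps)
  show "- a + a = 0"
    by transfer (simp add: cauchy_simps)
  show "a - b = a + - b"
    by (rule minus_padic_def)
  show "(a * b) * c = a * (b * c)"
    by transfer (simp add: ac_simps cauchy_simps)
  show "a * b = b * a"
    by transfer (simp add: ac_simps cauchy_simps)
  show "1 * a = a"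
    by transfer (simp add: cauchy_simps)
  show "(a + b) * c = a * c + b * c"
    by transfer (simp add: distrib_right cauchy_simps)
  show "(0 :: 'a padic) \<noteq> 1"
    by transfer (simp add: cauchy_simps padic_null_def prime_card LIMSEQ_const_iff)
  show "a \<noteq> 0 \<Longrightarrow> inverse a * a = 1"
    by transfer (auto simp: cauchy_simps padic_inverse_null[OF prime_card]
        padic_cauchy_inverse[OF prime_card])
  show "a div b = a * inverse b"
    by (rule divide_padic_def)
  show "inverse (0 :: 'a padic) = 0"
    by transfer (simp add: cauchy_simps)
qed

end

text \<open>
  \<open>padic_norm\<close> is the continuous extension of \<open>padic_abs\<close>; it induces the metric, hence the topology,
  of \<open>'p padic\<close>. The overloaded \<open>norm\<close> cannot be used here, since the library reserves it for real
  normed vector spaces.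
\<close>

lift_definition padic_norm :: "'p::prime_card padic \<Rightarrow> real"
  is "\<lambda>X. lim (\<lambda>n. padic_abs CARD('p) (X n))"
  by (rule padic_rel_lim_abs[OF prime_card])

lemma norm_abs_padic:
  assumes "padic_cauchy CARD('p::prime_card) X"
  shows "(\<lambda>n. padic_abs CARD('p) (X n)) \<longlonglongrightarrow> padic_norm (abs_padic X :: 'p padic)"
  using padic_cauchy_abs_convergent[OF prime_card assms]
  by (simp add: padic_norm.abs_eq padic_rel_refl assms convergent_LIMSEQ_iff)

lemma padic_cases_norm:
  fixes x :: "'p::prime_card padic"
  obtains X where "padic_cauchy CARD('p) X" "x = abs_padic X"
    "(\<lambda>n. padic_abs CARD('p) (X n)) \<longlonglongrightarrow> padic_norm x"
proof -
  have "padic_rel CARD('p) (rep_padic x) (rep_padic x)" "abs_padic (rep_padic x) = x"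
    by (rule Quotient3_rep_reflp[OF Quotient3_padic], rule Quotient3_abs_rep[OF Quotient3_padic])
  then have X: "padic_cauchy CARD('p) (rep_padic x)" "x = abs_padic (rep_padic x)"
    by (simp_all add: padic_rel_def)
  show ?thesis
    by (rule that[OF X]) (use norm_abs_padic[OF X(1)] X(2) in simp)
qed

lemma add_abs_padic:
  fixes X Y :: "nat \<Rightarrow> rat"
  assumes "padic_cauchy CARD('p::prime_card) X" "padic_cauchy CARD('p) Y"
  shows "(abs_padic X :: 'p padic) + abs_padic Y = abs_padic (\<lambda>n. X n + Y n)"
  using assms by (simp add: plus_padic.abs_eq padic_rel_refl)

lemma diff_abs_padic:
  fixes X Y :: "nat \<Rightarrow> rat"
  assumes "padic_cauchy CARD('p::prime_card) X" "padic_cauchy CARD('p) Y"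
  shows "(abs_padic X :: 'p padic) - abs_padic Y = abs_padic (\<lambda>n. X n - Y n)"
  using assms by (simp add: minus_padic_def plus_padic.abs_eq uminus_padic.abs_eq padic_rel_refl
      padic_cauchy_minus[OF prime_card])

lemma padic_norm_nonneg [simp]: "0 \<le> padic_norm (x :: 'p::prime_card padic)"
proof (rule padic_cases_norm[of x])
  fix X assume "(\<lambda>n. padic_abs CARD('p) (X n)) \<longlonglongrightarrow> padic_norm x"
  then show ?thesis by (rule LIMSEQ_le_const) (simp add: prime_card)
qed

lemma padic_norm_eq_0_iff [simp]: "padic_norm x = 0 \<longleftrightarrow> x = 0" for x :: "'p::prime_card padic"
proof (rule padic_cases_norm[of x])
  fix X assume X: "padic_cauchy CARD('p) X" "x = abs_padic X"
    "(\<lambda>n. padic_abs CARD('p) (X n)) \<longlonglongrightarrow> padic_norm x"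
  have "x = 0 \<longleftrightarrow> padic_rel CARD('p) X (\<lambda>n. 0)"
    unfolding X(2) zero_padic_def
    using Quotient3_rel[OF Quotient3_padic[where 'p = 'p], of X "\<lambda>n. 0"]
      padic_rel_refl[OF X(1)] padic_rel_refl[OF padic_cauchy_const, of "CARD('p)" 0]
    by simp
  also have "\<dots> \<longleftrightarrow> padic_null CARD('p) X" using X(1) by (simp add: padic_rel_def)
  also have "\<dots> \<longleftrightarrow> padic_norm x = 0"
  proof
    assume "padic_null CARD('p) X"
    then show "padic_norm x = 0" using X(3) LIMSEQ_unique unfolding padic_null_def by blast
  next
    assume "padic_norm x = 0"
    then show "padic_null CARD('p) X" using X(3) unfolding padic_null_def by (rule subst)
  qed
  finally show ?thesis by simp
qed

lemma padic_norm_zero [simp]: "padic_norm (0 :: 'p::prime_card padic) = 0"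
  by simp

lemma padic_norm_mult: "padic_norm (x * y) = padic_norm x * padic_norm y" for x y :: "'p::prime_card padic"
proof (rule padic_cases_norm[of x], rule padic_cases_norm[of y])
  fix X Y
  assume X: "padic_cauchy CARD('p) X" "x = abs_padic X"
    "(\<lambda>n. padic_abs CARD('p) (X n)) \<longlonglongrightarrow> padic_norm x"
  assume Y: "padic_cauchy CARD('p) Y" "y = abs_padic Y"
    "(\<lambda>n. padic_abs CARD('p) (Y n)) \<longlonglongrightarrow> padic_norm y"
  have "x * y = abs_padic (\<lambda>n. X n * Y n)"
    using X Y by (simp add: times_padic.abs_eq padic_rel_refl)
  then have "(\<lambda>n. padic_abs CARD('p) (X n * Y n)) \<longlonglongrightarrow> padic_norm (x * y)"
    using norm_abs_padic[OF padic_cauchy_mult[OF prime_card X(1) Y(1)]] by simp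
  moreover have "(\<lambda>n. padic_abs CARD('p) (X n * Y n)) \<longlonglongrightarrow> padic_norm x * padic_norm y"
    using tendsto_mult[OF X(3) Y(3)] by (simp add: padic_abs_mult[OF prime_card])
  ultimately show ?thesis by (rule LIMSEQ_unique)
qed

lemma padic_norm_ultra: "padic_norm (x + y) \<le> max (padic_norm x) (padic_norm y)"
  for x y :: "'p::prime_card padic"
proof (rule padic_cases_norm[of x], rule padic_cases_norm[of y])
  fix X Y
  assume X: "padic_cauchy CARD('p) X" "x = abs_padic X"
    "(\<lambda>n. padic_abs CARD('p) (X n)) \<longlonglongrightarrow> padic_norm x"
  assume Y: "padic_cauchy CARD('p) Y" "y = abs_padic Y"
    "(\<lambda>n. padic_abs CARD('p) (Y n)) \<longlonglongrightarrow> padic_norm y"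
  have "(\<lambda>n. padic_abs CARD('p) (X n + Y n)) \<longlonglongrightarrow> padic_norm (x + y)"
    using norm_abs_padic[OF padic_cauchy_add[OF prime_card X(1) Y(1)]] X Y
    by (simp add: add_abs_padic)
  then show ?thesis
    by (rule LIMSEQ_le[OF _ tendsto_max[OF X(3) Y(3)]])
       (use padic_abs_ultra[OF prime_card] in blast)
qed

lemma padic_norm_minus [simp]: "padic_norm (- x) = padic_norm x" for x :: "'p::prime_card padic"
proof (rule padic_cases_norm[of x])
  fix X assume X: "padic_cauchy CARD('p) X" "x = abs_padic X"
    "(\<lambda>n. padic_abs CARD('p) (X n)) \<longlonglongrightarrow> padic_norm x"
  have "- x = abs_padic (\<lambda>n. - X n)"
    using X by (simp add: uminus_padic.abs_eq padic_rel_refl)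
  then have "(\<lambda>n. padic_abs CARD('p) (- X n)) \<longlonglongrightarrow> padic_norm (- x)"
    using norm_abs_padic[OF padic_cauchy_minus[OF prime_card X(1)]] by simp
  then have "(\<lambda>n. padic_abs CARD('p) (X n)) \<longlonglongrightarrow> padic_norm (- x)"
    by (simp add: padic_abs_minus[OF prime_card])
  then show ?thesis using X(3) by (rule LIMSEQ_unique)
qed

lemma padic_norm_triangle: "padic_norm (x + y) \<le> padic_norm x + padic_norm y" for x y :: "'p::prime_card padic"
  using padic_norm_ultra[of x y] padic_norm_nonneg[of x] padic_norm_nonneg[of y] by linarith

lemma of_nat_padic: "(of_nat k :: 'p::prime_card padic) = abs_padic (\<lambda>n. of_nat k)"
proof (induction k)
  case 0
  then show ?case by (simp add: zero_padic_def)
next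
  case (Suc k)
  then show ?case by (simp add: one_padic_def add_abs_padic)
qed

instance padic :: (prime_card) field_char_0
proof
  show "inj (of_nat :: nat \<Rightarrow> 'a padic)"
  proof (rule injI)
    fix j k :: nat assume "(of_nat j :: 'a padic) = of_nat k"
    then have "(abs_padic (\<lambda>n. of_nat j - of_nat k) :: 'a padic) = 0"
      using diff_abs_padic[of "\<lambda>n. of_nat j" "\<lambda>n. of_nat k", where 'p = 'a]
      by (simp add: of_nat_padic)
    then have "(\<lambda>n::nat. padic_abs CARD('a) (of_nat j - of_nat k)) \<longlonglongrightarrow> 0"
      using norm_abs_padic[of "\<lambda>n. of_nat j - of_nat k", where 'p = 'a] by simp
    then show "j = k" by (simp add: LIMSEQ_const_iff prime_card)
  qed
qed

lemma of_int_padic: "(of_int k :: 'p::prime_card padic) = abs_padic (\<lambda>n. of_int k)"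
  by (cases k rule: int_diff_cases) (simp add: of_nat_padic diff_abs_padic)

lemma of_rat_padic: "(of_rat q :: 'p::prime_card padic) = abs_padic (\<lambda>n. q)"
proof -
  obtain a b where q: "q = of_int a / of_int b" "b \<noteq> 0"
    using rat_fraction_cases[OF prime_card[where 'a = 'p]] by metis
  have "(abs_padic (\<lambda>n. q) :: 'p padic) * of_int b = of_int a"
    unfolding of_int_padic using q by (simp add: times_padic.abs_eq padic_rel_refl)
  then have "abs_padic (\<lambda>n. q) = (of_int a / of_int b :: 'p padic)"
    using q(2) by (simp add: eq_divide_eq)
  then show ?thesis unfolding q(1) by (simp add: of_rat_divide)
qed

lemma padic_norm_of_rat [simp]: "padic_norm (of_rat q :: 'p::prime_card padic) = padic_abs CARD('p) q"
  using norm_abs_padic[of "\<lambda>n. q", where 'p = 'p]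
  by (simp add: of_rat_padic LIMSEQ_const_iff)

instantiation padic :: (prime_card) metric_space
begin

definition "dist x y = padic_norm (x - y)" for x y :: "'a padic"

definition "uniformity = (INF e\<in>{0<..}. principal {(x, y :: 'a padic). dist x y < e})"

definition "open U \<longleftrightarrow> (\<forall>x\<in>U. eventually (\<lambda>(x', y). x' = x \<longrightarrow> y \<in> U) uniformity)"
  for U :: "'a padic set"

instance
proof
  show "uniformity = (INF e\<in>{0<..}. principal {(x, y :: 'a padic). dist x y < e})"
    by (rule uniformity_padic_def)
  show "open U \<longleftrightarrow> (\<forall>x\<in>U. eventually (\<lambda>(x', y). x' = x \<longrightarrow> y \<in> U) uniformity)"
    for U :: "'a padic set"
    by (rule open_padic_def)
  fix x y z :: "'a padic"
  show "dist x y = 0 \<longleftrightarrow> x = y" by (simp add: dist_padic_def)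
  have "padic_norm (y - z) = padic_norm (z - y)"
    using padic_norm_minus[of "y - z"] by simp
  then show "dist x y \<le> dist x z + dist y z"
    using padic_norm_triangle[of "x - z" "z - y"] by (simp add: dist_padic_def)
qed

end

lemma padic_rat_sequence_tendsto:
  assumes X: "padic_cauchy CARD('p::prime_card) X"
  shows "(\<lambda>n. of_rat (X n) :: 'p padic) \<longlonglongrightarrow> abs_padic X"
proof (rule metric_LIMSEQ_I)
  fix e :: real assume "e > 0"
  then obtain M where M: "\<And>m n. m \<ge> M \<Longrightarrow> n \<ge> M \<Longrightarrow> padic_abs CARD('p) (X m - X n) < e / 2"
    using padic_cauchyD[OF X, of "e / 2"] by auto
  have "dist (of_rat (X m)) (abs_padic X :: 'p padic) < e" if "m \<ge> M" for m
  proof -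
    have "(of_rat (X m) :: 'p padic) - abs_padic X = abs_padic (\<lambda>n. X m - X n)"
      using X by (simp add: of_rat_padic diff_abs_padic)
    moreover have "padic_cauchy CARD('p) (\<lambda>n. X m - X n)"
      using padic_cauchy_add[OF prime_card padic_cauchy_const padic_cauchy_minus[OF prime_card X]]
      by simp
    ultimately have "(\<lambda>n. padic_abs CARD('p) (X m - X n)) \<longlonglongrightarrow>
        dist (of_rat (X m)) (abs_padic X :: 'p padic)"
      using norm_abs_padic[of "\<lambda>n. X m - X n", where 'p = 'p] by (simp add: dist_padic_def)
    then have "dist (of_rat (X m)) (abs_padic X :: 'p padic) \<le> e / 2"
      by (rule LIMSEQ_le_const2) (use M[OF that] less_imp_le in blast)
    then show ?thesis using \<open>e > 0\<close> by simp
  qed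
  then show "\<exists>M. \<forall>m\<ge>M. dist (of_rat (X m)) (abs_padic X :: 'p padic) < e" by blast
qed

lemma padic_rat_dense:
  fixes x :: "'p::prime_card padic"
  assumes "e > 0"
  obtains q where "dist (of_rat q) x < e"
proof (rule padic_cases_norm[of x])
  fix X assume X: "padic_cauchy CARD('p) X" "x = abs_padic X"
  show ?thesis
    using that metric_LIMSEQ_D[OF padic_rat_sequence_tendsto[OF X(1)] assms] X(2) by blast
qed

instance padic :: (prime_card) complete_space
proof
  fix x :: "nat \<Rightarrow> 'a padic" assume x: "Cauchy x"
  have "\<exists>q. dist (of_rat q) (x n) < inverse (real (Suc n))" for n
    using padic_rat_dense[of "inverse (real (Suc n))" "x n"] by auto
  then obtain q where q: "\<And>n. dist (of_rat (q n)) (x n) < inverse (real (Suc n))" by metis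
  have d0: "(\<lambda>n. dist (of_rat (q n)) (x n)) \<longlonglongrightarrow> 0"
    by (rule Lim_null_comparison[OF _ LIMSEQ_inverse_real_of_nat])
       (use q in \<open>auto intro!: always_eventually less_imp_le\<close>)
  have "padic_cauchy CARD('a) q"
    unfolding padic_cauchy_def
  proof (intro allI impI)
    fix e :: real assume "e > 0"
    obtain M where M: "\<And>m n. m \<ge> M \<Longrightarrow> n \<ge> M \<Longrightarrow> dist (x m) (x n) < e / 3"
      using metric_CauchyD[OF x, of "e / 3"] \<open>e > 0\<close> by auto
    obtain N where N: "\<And>n. n \<ge> N \<Longrightarrow> dist (of_rat (q n)) (x n) < e / 3"
      using metric_LIMSEQ_D[OF d0, of "e / 3"] \<open>e > 0\<close> by (auto simp: dist_real_def)
    have "padic_abs CARD('a) (q m - q n) < e" if "m \<ge> max M N" "n \<ge> max M N" for m n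
    proof -
      have "padic_abs CARD('a) (q m - q n) = dist (of_rat (q m) :: 'a padic) (of_rat (q n))"
        by (simp add: dist_padic_def of_rat_diff[symmetric])
      also have "\<dots> \<le> dist (of_rat (q m)) (x m) + dist (x m) (x n) + dist (of_rat (q n)) (x n)"
        using dist_triangle[of "of_rat (q m)" "of_rat (q n)" "x m"]
          dist_triangle2[of "x m" "of_rat (q n)" "x n"] by linarith
      also have "\<dots> < e" using M[of m n] N[of m] N[of n] that by simp
      finally show ?thesis .
    qed
    then show "\<exists>M. \<forall>m\<ge>M. \<forall>n\<ge>M. padic_abs CARD('a) (q m - q n) < e" by blast
  qed
  then have "(\<lambda>n. of_rat (q n)) \<longlonglongrightarrow> (abs_padic q :: 'a padic)"
    by (rule padic_rat_sequence_tendsto)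
  then have "(\<lambda>n. dist (of_rat (q n)) (abs_padic q :: 'a padic)) \<longlonglongrightarrow> 0"
    by (rule tendsto_dist_iff[THEN iffD1])
  from tendsto_add[OF d0 this]
  have "(\<lambda>n. dist (of_rat (q n)) (x n) + dist (of_rat (q n)) (abs_padic q :: 'a padic)) \<longlonglongrightarrow> 0"
    by simp
  then have "(\<lambda>n. dist (x n) (abs_padic q)) \<longlonglongrightarrow> 0"
  proof (rule Lim_null_comparison[rotated])
    show "\<forall>\<^sub>F n in sequentially. norm (dist (x n) (abs_padic q)) \<le>
        dist (of_rat (q n)) (x n) + dist (of_rat (q n)) (abs_padic q :: 'a padic)"
      by (intro always_eventually allI) (simp add: dist_triangle3)
  qed
  then have "x \<longlonglongrightarrow> abs_padic q"
    by (rule tendsto_dist_iff[THEN iffD2])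
  then show "convergent x" by (auto simp: convergent_def)
qed


section \<open>The recurrence\<close>

text \<open>
  \<open>mcf_A m a i n\<close> is \<open>A\<close> with superscript \<open>i\<close> and subscript \<open>n\<close>, where \<open>a i n\<close> is \<open>a\<close> with
  superscript \<open>i\<close> and subscript \<open>n\<close>. Only the subscripts \<open>n \<ge> - m\<close> are meaningful.
\<close>

function mcf_A :: "nat \<Rightarrow> (nat \<Rightarrow> nat \<Rightarrow> 'a::field) \<Rightarrow> nat \<Rightarrow> int \<Rightarrow> 'a" where
  "mcf_A m a i n =
     (if n < - int m then 0
      else if n < 0 then (if n = - int i then 1 else 0)
      else if n = 0 then a i 0
      else (\<Sum>j = 1..m + 1. a j (nat n) * mcf_A m a i (n - int j)))"
  by auto
termination
  by (relation "Wellfounded.measure (\<lambda>(m, a, i, n). nat n)") auto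

declare mcf_A.simps [simp del]

definition mcf_Q :: "nat \<Rightarrow> (nat \<Rightarrow> nat \<Rightarrow> 'a::field) \<Rightarrow> nat \<Rightarrow> nat \<Rightarrow> 'a" where
  "mcf_Q m a i n = mcf_A m a i (int n) / mcf_A m a (m + 1) (int n)"

lemma mcf_A_neg:
  "j \<in> {1..m} \<Longrightarrow> mcf_A m a i (- int j) = (if i = j then 1 else 0)"
  by (auto simp: mcf_A.simps)

lemma mcf_A_0: "mcf_A m a i 0 = a i 0"
  by (simp add: mcf_A.simps)

lemma mcf_A_pos:
  "n \<ge> 1 \<Longrightarrow> mcf_A m a i (int n) = (\<Sum>j = 1..m + 1. a j n * mcf_A m a i (int n - int j))"
  by (subst mcf_A.simps) simp

end

theory Submission
  imports Defs
begin

text \<open>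
  Let \<open>D\<close> be the sequence of denominators \<open>A\<close> with superscript \<open>m + 1\<close>. The dominance of
  \<open>a 1 n\<close> gives \<open>|D (n + 1)| = |a 1 (n + 1)| |D n|\<close>, and the recurrence then expresses
  \<open>Q (n + 1)\<close> as an affine combination of \<open>Q n, \<dots>, Q (n - m)\<close> in which the weight of \<open>Q n\<close> has
  absolute value 1 and, the value group being discrete, all others have absolute value at most
  \<open>1 / p\<close>. Hence an increment \<open>Q (n + 1) - Q n\<close> is at most \<open>1 / p\<close> times the largest of the
  preceding \<open>m\<close> increments. So the increments tend to 0, which suffices for convergence in a
  complete ultrametric field.
\<close>

section \<open>The p-adic norm\<close>

lemma padic_norm_diff_commute: "padic_norm (x - y) = padic_norm (y - x)"
  for x y :: "'p::prime_card padic"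
  using padic_norm_minus[of "x - y"] by simp

text \<open>The ultrametric inequality for \<open>x = (x + y) + (- y)\<close> leaves only
  \<open>x + y\<close> to account for the larger norm.\<close>

lemma padic_norm_add_eq_left:
  fixes x y :: "'p::prime_card padic"
  assumes "padic_norm y < padic_norm x"
  shows "padic_norm (x + y) = padic_norm x"
  using padic_norm_ultra[of x y] padic_norm_ultra[of "x + y" "- y"] assms by simp

text \<open>\<open>0 \<le> B\<close> covers sums over empty or infinite \<open>S\<close>, which are
  0.\<close>

lemma padic_norm_sum_le:
  fixes f :: "'b \<Rightarrow> 'p::prime_card padic"
  assumes "0 \<le> B" "\<And>x. x \<in> S \<Longrightarrow> padic_norm (f x) \<le> B"
  shows "padic_norm (sum f S) \<le> B"
  using assms(2)
proof (induction S rule: infinite_finite_induct)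
  case (insert x F)
  then show ?case
    using padic_norm_ultra[of "f x" "sum f F"] by fastforce
qed (use assms(1) in simp_all)

text \<open>A rational closer to \<open>x\<close> than \<open>padic_norm x\<close> has the same norm
  as \<open>x\<close>, so completion adds no new values.\<close>

lemma padic_norm_eq_powi:
  fixes x :: "'p::prime_card padic"
  assumes "x \<noteq> 0"
  obtains k where "padic_norm x = real CARD('p) powi k"
proof -
  have pos: "padic_norm x > 0"
    using assms padic_norm_nonneg[of x] padic_norm_eq_0_iff[of x] by linarith
  obtain q where "dist (of_rat q) x < padic_norm x"
    using padic_rat_dense[OF pos] by blast
  then have "padic_norm (of_rat q :: 'p padic) = padic_norm x"
    using padic_norm_add_eq_left[of "of_rat q - x" x] by (simp add: dist_padic_def)
  then have "padic_abs CARD('p) q = padic_norm x" by simp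
  moreover from this pos have "q \<noteq> 0" by auto
  ultimately have "padic_norm x = real CARD('p) powi (- padic_val CARD('p) q)"
    by (simp add: padic_abs_def)
  then show ?thesis by (rule that)
qed

text \<open>Exponents of p are integers, so a strict inequality costs a full factor p. This makes
  the gap between \<open>a 1 n\<close> and the other coefficients uniform in
  \<open>n\<close>.\<close>

lemma padic_norm_less_imp_le_divide:
  fixes x y :: "'p::prime_card padic"
  assumes "padic_norm x < padic_norm y"
  shows "padic_norm x \<le> padic_norm y / CARD('p)"
proof (cases "x = 0")
  case False
  have p: "real CARD('p) > 1"
    using prime_gt_1_nat[OF prime_card[where 'a = 'p]] by simp
  have "y \<noteq> 0" using assms padic_norm_nonneg[of x] by (metis padic_norm_zero not_le)
  then obtain l where l: "padic_norm y = real CARD('p) powi l"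
    by (rule padic_norm_eq_powi)
  obtain k where k: "padic_norm x = real CARD('p) powi k"
    using False by (rule padic_norm_eq_powi)
  have "k \<le> l - 1"
  proof (rule ccontr)
    assume "\<not> k \<le> l - 1"
    then have "real CARD('p) powi l \<le> real CARD('p) powi k"
      using p by (intro power_int_increasing) auto
    then show False using assms k l by simp
  qed
  then have "real CARD('p) powi k \<le> real CARD('p) powi (l - 1)"
    using p by (intro power_int_increasing) auto
  then show ?thesis using p by (simp add: k l power_int_diff)
qed simp

section \<open>Sequences with small increments\<close>

text \<open>Telescoping; by the ultrametric inequality the bound does not grow with the number of
  increments.\<close>

lemma padic_norm_chain_le:
  fixes Q :: "nat \<Rightarrow> 'p::prime_card padic"
  assumes "0 \<le> B" "x \<le> y" "\<And>l. x \<le> l \<Longrightarrow> l < y \<Longrightarrow> padic_norm (Q (Suc l) - Q l) \<le> B"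
  shows "padic_norm (Q y - Q x) \<le> B"
proof -
  have "Q y - Q x = (\<Sum>l = x..<y. Q (Suc l) - Q l)"
    using assms(2) by (simp add: sum_Suc_diff')
  then show ?thesis
    using padic_norm_sum_le[OF assms(1), of "{x..<y}" "\<lambda>l. Q (Suc l) - Q l"] assms(3) by simp
qed

lemma padic_convergent_if_increments_null:
  fixes Q :: "nat \<Rightarrow> 'p::prime_card padic"
  assumes "(\<lambda>n. padic_norm (Q (Suc n) - Q n)) \<longlonglongrightarrow> 0"
  shows "convergent Q"
proof -
  have "Cauchy Q"
  proof (rule metric_CauchyI)
    fix e :: real assume e: "e > 0"
    \<comment> \<open>The chain bound is only non-strict, hence \<open>e / 2\<close>.\<close>
    have "\<forall>\<^sub>F n in sequentially. padic_norm (Q (Suc n) - Q n) < e / 2"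
      using e by (intro order_tendstoD(2)[OF assms]) simp
    then obtain M where M: "\<And>n. n \<ge> M \<Longrightarrow> padic_norm (Q (Suc n) - Q n) < e / 2"
      by (auto simp: eventually_sequentially)
    have le: "padic_norm (Q y - Q x) < e" if "M \<le> x" "x \<le> y" for x y
    proof -
      have "padic_norm (Q y - Q x) \<le> e / 2"
      proof (rule padic_norm_chain_le)
        show "padic_norm (Q (Suc l) - Q l) \<le> e / 2" if "x \<le> l" for l
          using M[of l] \<open>M \<le> x\<close> that by simp
      qed (use e that in simp_all)
      with e show ?thesis by simp
    qed
    have "dist (Q x) (Q y) < e" if "M \<le> x" "M \<le> y" for x y
      using le[of x y] le[of y x] that padic_norm_diff_commute[of "Q x" "Q y"]
      by (cases "x \<le> y") (auto simp: dist_padic_def)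
    then show "\<exists>M. \<forall>x\<ge>M. \<forall>y\<ge>M. dist (Q x) (Q y) < e" by blast
  qed
  then show ?thesis by (rule Cauchy_convergent)
qed

text \<open>Each block of \<open>m\<close> indices gains a factor \<open>c\<close>, so the decay is
  geometric in the number of blocks.\<close>

lemma tendsto_zero_if_contracts_window:
  fixes d :: "nat \<Rightarrow> real"
  assumes d: "\<And>n. 0 \<le> d n" and c: "0 \<le> c" "c < 1"
    and step: "\<And>n B. m \<le> n \<Longrightarrow> 0 \<le> B \<Longrightarrow> (\<And>k. k \<in> {1..m} \<Longrightarrow> d (n - k) \<le> B) \<Longrightarrow> d n \<le> c * B"
  shows "d \<longlonglongrightarrow> 0"
proof -
  \<comment> \<open>As a sum of nonnegative terms, \<open>C\<close> bounds each of the first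
    \<open>m\<close> values.\<close>
  define C where "C = (\<Sum>l<m. d l)"
  have C: "0 \<le> C" unfolding C_def by (simp add: d sum_nonneg)
  have decay: "d n \<le> c ^ k * C" if "k * m \<le> n" for n k
    using that
  proof (induction k arbitrary: n)
    case 0
    show ?case
    proof (induction n rule: less_induct)
      case (less n)
      show ?case
      proof (cases "n < m")
        case True
        then show ?thesis unfolding C_def using d by (simp add: member_le_sum)
      next
        case False
        then have "d n \<le> c * C" using C less.IH by (intro step) auto
        also have "\<dots> \<le> C" using c C by (simp add: mult_left_le_one_le)
        finally show ?thesis by simp
      qed
    qed
  next
    case (Suc k)
    \<comment> \<open>From \<open>Suc k * m \<le> n\<close>, the whole window before
      \<open>n\<close> lies at or beyond \<open>k * m\<close>, where the induction hypothesis
      applies.\<close>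
    have "d n \<le> c * (c ^ k * C)"
      using Suc c C by (intro step) auto
    then show ?case by (simp add: mult.assoc)
  qed
  have lim: "(\<lambda>k. c ^ k * C) \<longlonglongrightarrow> 0"
    using c by (intro tendsto_mult_left_zero LIMSEQ_power_zero) simp
  show ?thesis
  proof (rule LIMSEQ_I)
    fix e :: real assume "e > 0"
    then have "\<forall>\<^sub>F k in sequentially. c ^ k * C < e"
      by (rule order_tendstoD(2)[OF lim])
    then obtain k where "c ^ k * C < e" by (auto simp: eventually_sequentially)
    then have "norm (d n - 0) < e" if "k * m \<le> n" for n
      using decay[OF that] d[of n] by simp
    then show "\<exists>M. \<forall>n\<ge>M. norm (d n - 0) < e" by blast
  qed
qed

section \<open>The convergents\<close>

text \<open>Below \<open>- m\<close> this is the default value 0, so monotonicity of the norms can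
  be stated for all \<open>l \<le> int n\<close>.\<close>

lemma mcf_A_denominator_neg: "l < 0 \<Longrightarrow> mcf_A m a (m + 1) l = 0"
  by (auto simp: mcf_A.simps)

text \<open>One induction carries positivity and monotonicity: together they make the term
  \<open>j = 1\<close> strictly dominant in the recurrence, which gives the norm of the next
  denominator and so both properties there.\<close>

lemma mcf_A_denominator_norm:
  fixes a :: "nat \<Rightarrow> nat \<Rightarrow> 'p::prime_card padic" and m n :: nat and c :: real
  defines "D \<equiv> mcf_A m a (m + 1)"
  assumes a0: "a (m + 1) 0 = 1" and a1: "\<And>n. n \<ge> 1 \<Longrightarrow> padic_norm (a 1 n) \<ge> 1"
    and c: "0 \<le> c" "c < 1"
    and small: "\<And>n j. n \<ge> 1 \<Longrightarrow> j \<in> {2..m + 1} \<Longrightarrow> padic_norm (a j n) \<le> c * padic_norm (a 1 n)"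
  shows mcf_A_denominator_norm_pos: "0 < padic_norm (D (int n))"
    and mcf_A_denominator_norm_mono: "\<And>l. l \<le> int n \<Longrightarrow> padic_norm (D l) \<le> padic_norm (D (int n))"
    and mcf_A_denominator_norm_Suc:
      "padic_norm (D (int (Suc n))) = padic_norm (a 1 (Suc n)) * padic_norm (D (int n))"
proof -
  have norm_Suc: "padic_norm (D (int (Suc n))) = padic_norm (a 1 (Suc n)) * padic_norm (D (int n))"
    if pos: "0 < padic_norm (D (int n))"
      and mono: "\<forall>l\<le>int n. padic_norm (D l) \<le> padic_norm (D (int n))" for n
  proof -
    let ?N = "padic_norm (a 1 (Suc n)) * padic_norm (D (int n))"
    let ?R = "\<Sum>j = 2..m + 1. a j (Suc n) * D (int (Suc n) - int j)"
    have N: "?N > 0" using pos a1[of "Suc n"] by simp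
    have "padic_norm ?R \<le> c * ?N"
    proof (rule padic_norm_sum_le)
      show "0 \<le> c * ?N" using N c by simp
      fix j assume "j \<in> {2..m + 1}"
      then have "padic_norm (a j (Suc n)) * padic_norm (D (int (Suc n) - int j))
          \<le> (c * padic_norm (a 1 (Suc n))) * padic_norm (D (int n))"
        using c by (intro mult_mono small mono[rule_format]) auto
      then show "padic_norm (a j (Suc n) * D (int (Suc n) - int j)) \<le> c * ?N"
        by (simp add: padic_norm_mult mult.assoc)
    qed
    also have "c * ?N < ?N" using mult_strict_right_mono[OF c(2) N] by simp
    finally have R: "padic_norm ?R < padic_norm (a 1 (Suc n) * D (int n))"
      by (simp add: padic_norm_mult)
    have "D (int (Suc n)) = a 1 (Suc n) * D (int n) + ?R"
      unfolding D_def by (subst mcf_A_pos) (simp_all add: sum.atLeast_Suc_atMost numeral_2_eq_2)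
    then show ?thesis using padic_norm_add_eq_left[OF R] by (simp add: padic_norm_mult)
  qed
  have inv: "0 < padic_norm (D (int n)) \<and> (\<forall>l\<le>int n. padic_norm (D l) \<le> padic_norm (D (int n)))" for n
  proof (induction n)
    case 0
    have "padic_norm (1 :: 'p padic) * padic_norm (1 :: 'p padic) = padic_norm (1 :: 'p padic)"
      by (simp add: padic_norm_mult[symmetric])
    then have "padic_norm (1 :: 'p padic) = 1" by simp
    then have D0: "padic_norm (D 0) = 1" by (simp add: D_def mcf_A_0 a0[simplified])
    have "padic_norm (D l) \<le> padic_norm (D 0)" if "l \<le> 0" for l
      using that D0 mcf_A_denominator_neg[of l m a] by (cases "l = 0") (auto simp: D_def)
    then show ?case using D0 by simp
  next
    case (Suc n)
    have eq: "padic_norm (D (int (Suc n))) = padic_norm (a 1 (Suc n)) * padic_norm (D (int n))"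
      using Suc.IH by (intro norm_Suc) auto
    \<comment> \<open>Here \<open>padic_norm (a 1 (Suc n)) \<ge> 1\<close> keeps the norms from
      decreasing.\<close>
    then have le: "padic_norm (D (int n)) \<le> padic_norm (D (int (Suc n)))"
      using Suc.IH a1[of "Suc n"] by (simp add: mult_le_cancel_right1)
    have "padic_norm (D l) \<le> padic_norm (D (int (Suc n)))" if "l \<le> int (Suc n)" for l
    proof (cases "l = int (Suc n)")
      case False
      then have "l \<le> int n" using that by simp
      then show ?thesis using Suc.IH le by force
    qed simp
    moreover have "0 < padic_norm (D (int (Suc n)))" using Suc.IH le by linarith
    ultimately show ?case by blast
  qed
  show "0 < padic_norm (D (int n))"
    and "\<And>l. l \<le> int n \<Longrightarrow> padic_norm (D l) \<le> padic_norm (D (int n))"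
    using inv[of n] by auto
  show "padic_norm (D (int (Suc n))) = padic_norm (a 1 (Suc n)) * padic_norm (D (int n))"
    using inv[of n] by (intro norm_Suc) auto
qed

text \<open>Subtract \<open>mcf_Q m a i n\<close> times the recurrence for \<open>D\<close> from
  that for the numerators, written as \<open>D\<close> times convergent. The term
  \<open>j = 1\<close> cancels. By \<open>m \<le> n\<close> all subscripts are nonnegative and the
  natural subtraction is exact.\<close>

lemma mcf_Q_increment:
  fixes m n :: nat and a :: "nat \<Rightarrow> nat \<Rightarrow> 'a::field"
  defines "D \<equiv> \<lambda>l. mcf_A m a (m + 1) (int l)"
  assumes nz: "\<And>l. D l \<noteq> 0" and "m \<le> n"
  shows "D (Suc n) * (mcf_Q m a i (Suc n) - mcf_Q m a i n) =
    (\<Sum>j = 2..m + 1. a j (Suc n) * (D (Suc n - j) * (mcf_Q m a i (Suc n - j) - mcf_Q m a i n)))"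
proof -
  have rec: "mcf_A m a k (int (Suc n)) =
      (\<Sum>j = 1..m + 1. a j (Suc n) * mcf_A m a k (int (Suc n - j)))" for k
    using \<open>m \<le> n\<close> by (subst mcf_A_pos) (auto intro!: sum.cong simp: of_nat_diff)
  have A: "mcf_A m a i (int l) = D l * mcf_Q m a i l" for l
    using nz[of l] by (simp add: mcf_Q_def D_def)
  have "D (Suc n) * mcf_Q m a i (Suc n) - D (Suc n) * mcf_Q m a i n =
      (\<Sum>j = 1..m + 1. a j (Suc n) * (D (Suc n - j) * mcf_Q m a i (Suc n - j))) -
      (\<Sum>j = 1..m + 1. a j (Suc n) * D (Suc n - j)) * mcf_Q m a i n"
    using rec[of i] rec[of "m + 1"] unfolding A unfolding D_def by (simp only:)
  also have "\<dots> = (\<Sum>j = 1..m + 1. a j (Suc n) *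
      (D (Suc n - j) * (mcf_Q m a i (Suc n - j) - mcf_Q m a i n)))"
    by (simp only: sum_distrib_right sum_subtractf[symmetric]) (simp add: algebra_simps)
  also have "\<dots> = (\<Sum>j = 2..m + 1. a j (Suc n) *
      (D (Suc n - j) * (mcf_Q m a i (Suc n - j) - mcf_Q m a i n)))"
    by (subst sum.atLeast_Suc_atMost) (simp_all add: numeral_2_eq_2)
  finally show ?thesis by (simp only: right_diff_distrib)
qed

theorem theorem3p3:
  fixes m :: nat and a :: "nat \<Rightarrow> nat \<Rightarrow> 'p::prime_card padic"
  assumes "m \<ge> 1"
    and "a (m + 1) 0 = 1"
    and "\<And>n. n \<ge> 1 \<Longrightarrow> padic_norm (a 1 n) \<ge> 1"
    and "\<And>n i. n \<ge> 1 \<Longrightarrow> i \<in> {2..m + 1} \<Longrightarrow> padic_norm (a i n) < padic_norm (a 1 n)"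
  shows "\<forall>i\<in>{1..m}. convergent (\<lambda>n. mcf_Q m a i n)"
proof
  fix i
  define c where "c = 1 / real CARD('p)"
  define D where "D = (\<lambda>l. mcf_A m a (m + 1) (int l))"
  define Q where "Q = mcf_Q m a i"
  have c: "0 \<le> c" "c < 1"
    unfolding c_def using prime_gt_1_nat[OF prime_card[where 'a = 'p]] by simp_all
  have small: "padic_norm (a j n) \<le> c * padic_norm (a 1 n)" if "n \<ge> 1" "j \<in> {2..m + 1}" for n j
    using padic_norm_less_imp_le_divide[OF assms(4)[OF that]] by (simp add: c_def)
  note norm_D = mcf_A_denominator_norm[of a m c, OF assms(2,3) c small]
  have pos: "0 < padic_norm (D l)" for l
    unfolding D_def using norm_D(1) by blast
  have "(\<lambda>n. padic_norm (Q (Suc n) - Q n)) \<longlonglongrightarrow> 0"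
  proof (rule tendsto_zero_if_contracts_window[OF _ c, where m = m])
    fix n B
    assume n: "m \<le> n" and B: "0 \<le> B"
      and window: "\<And>k. k \<in> {1..m} \<Longrightarrow> padic_norm (Q (Suc (n - k)) - Q (n - k)) \<le> B"
    \<comment> \<open>The path from \<open>Suc n - j\<close> to \<open>n\<close> has
      \<open>j - 1 \<le> m\<close> increments, all inside the window.\<close>
    have Q: "padic_norm (Q (Suc n - j) - Q n) \<le> B" if j: "j \<in> {2..m + 1}" for j
    proof -
      have "padic_norm (Q n - Q (Suc n - j)) \<le> B"
      proof (rule padic_norm_chain_le[OF B])
        show "Suc n - j \<le> n" using j by auto
        fix l assume l: "Suc n - j \<le> l" "l < n"
        then have "n - l \<in> {1..m}" using j by auto
        from window[OF this] show "padic_norm (Q (Suc l) - Q l) \<le> B"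
          using l by simp
      qed
      then show ?thesis by (simp add: padic_norm_diff_commute)
    qed
    \<comment> \<open>The estimate is made before dividing by \<open>D (Suc n)\<close>, whose
      positive norm cancels at the end.\<close>
    have "padic_norm (D (Suc n) * (Q (Suc n) - Q n)) \<le> padic_norm (D (Suc n)) * (c * B)"
      unfolding Q_def D_def
    proof (subst mcf_Q_increment[OF _ n], goal_cases)
      case (1 l)
      show ?case using pos[of l] by (auto simp: D_def)
    next
      case 2
      show ?case
        unfolding Q_def[symmetric]
      proof (rule padic_norm_sum_le)
        show "0 \<le> padic_norm (mcf_A m a (m + 1) (int (Suc n))) * (c * B)"
          using B c by simp
        fix j assume j: "j \<in> {2..m + 1}"
        have "padic_norm (D (Suc n - j)) \<le> padic_norm (D n)"
          unfolding D_def using j by (intro norm_D(2)) auto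
        then have "padic_norm (a j (Suc n)) * (padic_norm (D (Suc n - j)) * padic_norm (Q (Suc n - j) - Q n))
            \<le> (c * padic_norm (a 1 (Suc n))) * (padic_norm (D n) * B)"
          using j B c by (intro mult_mono small Q) auto
        \<comment> \<open>The exact growth law of the denominators absorbs
          \<open>a 1 (Suc n)\<close>, leaving only the factor \<open>c\<close>.\<close>
        also have "\<dots> = padic_norm (D (Suc n)) * (c * B)"
          unfolding D_def using norm_D(3)[of n] by (simp del: of_nat_Suc)
        finally show "padic_norm (a j (Suc n) *
            (mcf_A m a (m + 1) (int (Suc n - j)) * (Q (Suc n - j) - Q n)))
            \<le> padic_norm (mcf_A m a (m + 1) (int (Suc n))) * (c * B)"
          by (simp add: padic_norm_mult D_def)
      qed
    qed
    then show "padic_norm (Q (Suc n) - Q n) \<le> c * B"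
      using pos[of "Suc n"] by (simp add: padic_norm_mult)
  qed simp
  then show "convergent (\<lambda>n. mcf_Q m a i n)"
    using padic_convergent_if_increments_null[of Q] by (simp add: Q_def)
qed

end
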